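(* Let $X_1,\dots,X_n$ be independent discrete real-valued random variables, $\mathbf{X}=(X_1,\dots,X_n)$, let $T=T(X_1,\dots,X_n)$ be a discrete random variable (with $T$ a measurable function on $\mathbb{R}^n$), let $t\in\mathrm{range}(T)$, $E=\{T=t\}$, and let $I\subset\{1,\dots,n\}$ be an index set. Assume (DSH), (A1) and (A2) from the context. Then the following algorithm samples from the distribution $\mathcal{L}\big((X_1,\dots,X_n)\mid T=t\big)$: 1. Sample from $\mathcal{L}(X^{(I)})$; denote the observation by $x^{(I)}$. Independently sample $u$ uniformly from $(0,1)$. 2. If $x^{(I)}\in E^{(I)}$ and $u<\dfrac{\mathbb{P}(X_I=y_I)}{\max_{\ell}\mathbb{P}(X_I=\ell)}$, where $y_I=y_I(x^{(I)})$, return $\sigma_I(x^{(I)},y_I)$; otherwise restart (with fresh independent randomness).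
   Context: Write $[n]=\{1,\dots,n\}$ and $i=|I|$. Identify the event $E$ with the set $\{z\in\mathbb{R}^n: T(z)=t\}$. $X_I=(X_j)_{j\in I}\in\mathbb{R}^{i}$ and $X^{(I)}=(X_j)_{j\in[n]\setminus I}\in\mathbb{R}^{n-i}$. $\sigma_I:\mathbb{R}^{n-i}\times\mathbb{R}^{i}\to\mathbb{R}^n$ is the map that places the entries of its second argument in the coordinates indexed by $I$ and the entries of its first argument, in order, in the remaining coordinates, so that $\sigma_I(X^{(I)},X_I)=\mathbf{X}$. The $I$-completable set is $E^{(I)}=\{x\in\mathbb{R}^{n-i}:\exists\,y\in\mathbb{R}^i,\ \sigma_I(x,y)\in E\}$. (DSH), deterministic second half: for each $x\in E^{(I)}$ there is exactly one $y\in\mathbb{R}^i$ with $\sigma_I(x,y)\in E$; this unique completion is denoted $y_I(x)$. Put $q(x)=\mathbb{P}(X_I=y_I(x))$ for $x\in E^{(I)}$ and $q(x)=0$ for $x\notin E^{(I)}$. (A1): $0<\sup_x q(x)<\infty$. (A2): $\mathbb{P}(q(X^{(I)})>0)>0$. "Samples from" means exact sampling: the algorithm terminates in finite time with probability 1 and its output has exactly the stated distribution. *)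

theory Defs
  imports "HOL-Probability.Probability"
begin

text \<open>
  Real vectors indexed by a finite set \<open>J\<close> of positions are the extensional functions
  \<open>J \<rightarrow>\<^sub>E UNIV\<close>, with the product Borel sigma-algebra \<open>Pi\<^sub>M J (\<lambda>_. borel)\<close>.
  In particular the space of all vectors is \<open>{1..n} \<rightarrow>\<^sub>E UNIV\<close>, and the entries with
  position outside \<open>I\<close> keep their original positions instead of being renumbered
  \<open>1, \<dots>, n - card I\<close>.
\<close>

abbreviation RVec :: "nat set \<Rightarrow> (nat \<Rightarrow> real) measure"
  where "RVec J \<equiv> Pi\<^sub>M J (\<lambda>_. borel)"

definition discrete_rv :: "'w measure \<Rightarrow> ('w \<Rightarrow> 'b::topological_space) \<Rightarrow> bool"
  where "discrete_rv M Y \<longleftrightarrow>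
    Y \<in> borel_measurable M \<and> (\<exists>S. countable S \<and> (AE \<omega> in M. Y \<omega> \<in> S))"

definition subvec :: "nat set \<Rightarrow> (nat \<Rightarrow> 'w \<Rightarrow> real) \<Rightarrow> 'w \<Rightarrow> nat \<Rightarrow> real"
  where "subvec J X \<omega> = (\<lambda>j\<in>J. X j \<omega>)"

definition level_set :: "nat \<Rightarrow> ((nat \<Rightarrow> real) \<Rightarrow> 'b) \<Rightarrow> 'b \<Rightarrow> (nat \<Rightarrow> real) set"
  where "level_set n T t = {z \<in> {1..n} \<rightarrow>\<^sub>E UNIV. T z = t}"

definition place :: "nat \<Rightarrow> nat set \<Rightarrow> (nat \<Rightarrow> real) \<Rightarrow> (nat \<Rightarrow> real) \<Rightarrow> nat \<Rightarrow> real"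
  where "place n I x y = merge ({1..n} - I) I (x, y)"

definition completable :: "nat \<Rightarrow> nat set \<Rightarrow> (nat \<Rightarrow> real) set \<Rightarrow> (nat \<Rightarrow> real) set"
  where "completable n I E =
    {x \<in> ({1..n} - I) \<rightarrow>\<^sub>E UNIV. \<exists>y \<in> I \<rightarrow>\<^sub>E UNIV. place n I x y \<in> E}"

definition DSH :: "nat \<Rightarrow> nat set \<Rightarrow> (nat \<Rightarrow> real) set \<Rightarrow> bool"
  where "DSH n I E \<longleftrightarrow>
    (\<forall>x \<in> completable n I E. \<exists>!y. y \<in> I \<rightarrow>\<^sub>E UNIV \<and> place n I x y \<in> E)"

text \<open>Meaningful only for completable \<open>x\<close>, under \<^const>\<open>DSH\<close>.\<close>

definition completion :: "nat \<Rightarrow> nat set \<Rightarrow> (nat \<Rightarrow> real) set \<Rightarrow> (nat \<Rightarrow> real) \<Rightarrow> nat \<Rightarrow> real"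
  where "completion n I E x = (THE y. y \<in> I \<rightarrow>\<^sub>E UNIV \<and> place n I x y \<in> E)"

definition point_prob :: "'w measure \<Rightarrow> (nat \<Rightarrow> 'w \<Rightarrow> real) \<Rightarrow> nat set \<Rightarrow> (nat \<Rightarrow> real) \<Rightarrow> real"
  where "point_prob M X I y = measure M {\<omega> \<in> space M. subvec I X \<omega> = y}"

text \<open>
  The set of point probabilities is infinite in general as a set of reals, so \<^const>\<open>Max\<close>
  does not apply; \<^const>\<open>Greatest\<close> denotes its largest element, which exists for a
  discrete law.
\<close>

definition max_point_prob :: "'w measure \<Rightarrow> (nat \<Rightarrow> 'w \<Rightarrow> real) \<Rightarrow> nat set \<Rightarrow> real"
  where "max_point_prob M X I = (GREATEST p. p \<in> point_prob M X I ` (I \<rightarrow>\<^sub>E UNIV))"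

definition completion_prob ::
    "'w measure \<Rightarrow> (nat \<Rightarrow> 'w \<Rightarrow> real) \<Rightarrow> nat \<Rightarrow> nat set \<Rightarrow> (nat \<Rightarrow> real) set \<Rightarrow> (nat \<Rightarrow> real) \<Rightarrow> real"
  where "completion_prob M X n I E x =
    (if x \<in> completable n I E then point_prob M X I (completion n I E x) else 0)"

definition condition_A1 ::
    "'w measure \<Rightarrow> (nat \<Rightarrow> 'w \<Rightarrow> real) \<Rightarrow> nat \<Rightarrow> nat set \<Rightarrow> (nat \<Rightarrow> real) set \<Rightarrow> bool"
  where "condition_A1 M X n I E \<longleftrightarrow>
    0 < (SUP x \<in> ({1..n} - I) \<rightarrow>\<^sub>E UNIV. ereal (completion_prob M X n I E x)) \<and>
    (SUP x \<in> ({1..n} - I) \<rightarrow>\<^sub>E UNIV. ereal (completion_prob M X n I E x)) < \<infinity>"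

definition condition_A2 ::
    "'w measure \<Rightarrow> (nat \<Rightarrow> 'w \<Rightarrow> real) \<Rightarrow> nat \<Rightarrow> nat set \<Rightarrow> (nat \<Rightarrow> real) set \<Rightarrow> bool"
  where "condition_A2 M X n I E \<longleftrightarrow>
    measure M {\<omega> \<in> space M. completion_prob M X n I E (subvec ({1..n} - I) X \<omega>) > 0} > 0"

text \<open>
  The law of \<open>Y\<close> given the event \<open>A\<close>: \<^const>\<open>uniform_measure\<close> \<open>M A\<close> is the conditional
  probability \<open>B \<mapsto> P(A \<inter> B) / P(A)\<close>.
\<close>

definition cond_law :: "'w measure \<Rightarrow> 'w set \<Rightarrow> 'b measure \<Rightarrow> ('w \<Rightarrow> 'b) \<Rightarrow> 'b measure"
  where "cond_law M A S Y = distr (uniform_measure M A) S Y"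

text \<open>The space of this measure is the open interval itself, so every draw lies in it.\<close>

definition uniform01 :: "real measure"
  where "uniform01 = restrict_space lborel {0<..<1}"

text \<open>One pass of the algorithm on the draws \<open>(x, u)\<close>; \<^const>\<open>None\<close> means restart.\<close>

definition attempt ::
    "'w measure \<Rightarrow> (nat \<Rightarrow> 'w \<Rightarrow> real) \<Rightarrow> nat \<Rightarrow> nat set \<Rightarrow> (nat \<Rightarrow> real) set
      \<Rightarrow> (nat \<Rightarrow> real) \<times> real \<Rightarrow> (nat \<Rightarrow> real) option"
  where "attempt M X n I E = (\<lambda>(x, u).
    if x \<in> completable n I E \<and>
       u < point_prob M X I (completion n I E x) / max_point_prob M X I
    then Some (place n I x (completion n I E x)) else None)"

text \<open>
  The loop that uses the draws \<open>s 0, s 1, \<dots>\<close> in successive passes and returns the result of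
  the first pass that does not restart; \<^const>\<open>None\<close> means that it runs forever.
\<close>

definition restart_until_success :: "('s \<Rightarrow> 'r option) \<Rightarrow> (nat \<Rightarrow> 's) \<Rightarrow> 'r option"
  where "restart_until_success step s =
    (if \<exists>k. step (s k) \<noteq> None then step (s (LEAST k. step (s k) \<noteq> None)) else None)"

definition samples_from :: "'v measure \<Rightarrow> ('v \<Rightarrow> 'r option) \<Rightarrow> 'r measure \<Rightarrow> bool"
  where "samples_from P out Q \<longleftrightarrow>
    (AE w in P. out w \<noteq> None) \<and>
    (\<forall>A \<in> sets Q. {w \<in> space P. \<exists>r \<in> A. out w = Some r} \<in> sets P \<and>
       emeasure P {w \<in> space P. \<exists>r \<in> A. out w = Some r} = emeasure Q A)"

end

(* In a pass of the loop the pair (x, u) is accepted, with the result in A, exactly if for some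
   point y the vector z = place n I x y lies in E and in A and u < P(X_I = y) / m, where m is the
   largest point probability of X_I.  By (DSH) these events are disjoint for distinct y, so the
   probability of acceptance with a result in A is the sum over y of
   P(place n I X^(I) y : E Int A) * P(X_I = y) / m, which equals P(X : E Int A) / m by the
   independence of X^(I) and X_I.  It is therefore proportional to the conditional law, with a
   factor P(E) / m that is positive by (A2), and restarting until success normalises it
   (geometric series over the number of rejected passes). *)

theory Submission
  imports Defs
begin

text \<open>Think of \<open>U\<close> as the accepted draws and of \<open>V\<close> as those whose
  result is of interest. By independence the first acceptance occurs in pass \<open>k\<close>, with
  a draw in \<open>V\<close>, with probability \<open>(1 - measure D U) ^ k * measure D V\<close>.
  These events are disjoint in \<open>k\<close>, and \<open>pos\<close> makes the geometric series
  converge to the quotient.\<close>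

lemma (in prob_space) first_success:
  fixes Y :: "nat \<Rightarrow> 'a \<Rightarrow> 's"
  assumes indep: "indep_vars (\<lambda>_. D) Y UNIV" and law: "\<And>k. distr M D (Y k) = D"
    and U: "U \<in> sets D" and V: "V \<in> sets D" "V \<subseteq> U" and pos: "0 < measure D U"
  shows "{w \<in> space M. \<exists>k. Y k w \<in> V \<and> (\<forall>i<k. Y i w \<notin> U)} \<in> events" (is "?A \<in> events")
    and "prob {w \<in> space M. \<exists>k. Y k w \<in> V \<and> (\<forall>i<k. Y i w \<notin> U)} = measure D V / measure D U"
proof -
  have Y [measurable]: "Y k \<in> measurable M D" for k
    using indep by (auto simp: indep_vars_def)
  note [measurable] = U V(1)
  show ev: "?A \<in> events"
    by measurable
  have prob_Y: "prob (Y k -` C \<inter> space M) = measure D C" if "C \<in> sets D" for k C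
    using measure_distr[OF Y that, of k] law by simp
  interpret D: prob_space D
    using prob_space_distr[OF Y, of 0] law by simp
  define B where "B k = {w \<in> space M. Y k w \<in> V \<and> (\<forall>i<k. Y i w \<notin> U)}" for k
  have B_meas: "B k \<in> events" for k
    unfolding B_def by measurable
  have prob_B: "prob (B k) = (1 - measure D U) ^ k * measure D V" for k
  proof -
    \<comment> \<open>One family for both kinds of pass, rejection before \<open>k\<close> and a hit
      of \<open>V\<close> at \<open>k\<close>, so that independence applies to a single finite
      intersection.\<close>
    define C where "C i = (if i < k then space D - U else V)" for i
    have C: "C i \<in> sets D" for i
      by (auto simp: C_def)
    have "B k = (\<Inter>i\<in>{..k}. Y i -` C i \<inter> space M)"
      using measurable_space[OF Y] by (fastforce simp: B_def C_def split: if_splits)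
    also have "prob \<dots> = (\<Prod>i\<in>{..k}. prob (Y i -` C i \<inter> space M))"
      by (rule indep_varsD[OF indep]) (auto simp: C)
    also have "\<dots> = (\<Prod>i\<in>{..<Suc k}. measure D (C i))"
      by (simp add: prob_Y[OF C] lessThan_Suc_atMost)
    also have "\<dots> = (\<Prod>i\<in>{..<k}. 1 - measure D U) * measure D V"
      by (simp add: C_def D.prob_compl)
    finally show ?thesis
      by simp
  qed
  \<comment> \<open>Since \<open>V \<subseteq> U\<close>, a hit of \<open>V\<close> in pass
    \<open>i\<close> contradicts the rejection of pass \<open>i\<close> that \<open>B j\<close>
    demands.\<close>
  have disj: "B i \<inter> B j = {}" if "i < j" for i j
    using that V(2) by (auto simp: B_def)
  have "disjoint_family B"
    unfolding disjoint_family_on_def using disj by (metis inf_commute linorder_neqE_nat)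
  then have "(\<lambda>k. prob (B k)) sums prob (\<Union>k. B k)"
    using B_meas by (intro finite_measure_UNION) auto
  moreover have "(\<lambda>k. prob (B k)) sums (1 / (1 - (1 - measure D U)) * measure D V)"
    unfolding prob_B using pos D.prob_le_1[of U] by (intro sums_mult2 geometric_sums) auto
  moreover have "(\<Union>k. B k) = ?A"
    by (auto simp: B_def)
  ultimately show "prob ?A = measure D V / measure D U"
    using sums_unique2 by fastforce
qed

text \<open>Replaces \<open>LEAST\<close> by a quantifier over the successful pass, which is the
  shape of the event in \<open>first_success\<close>.\<close>

lemma restart_until_success_iff:
  "(\<exists>r\<in>A. restart_until_success step s = Some r) \<longleftrightarrow>
    (\<exists>k. (\<exists>r\<in>A. step (s k) = Some r) \<and> (\<forall>i<k. step (s i) = None))" (is "?l \<longleftrightarrow> ?r")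
proof
  assume ?l
  then have ex: "\<exists>k. step (s k) \<noteq> None"
    and "\<exists>r\<in>A. step (s (LEAST k. step (s k) \<noteq> None)) = Some r"
    by (auto simp: restart_until_success_def split: if_splits)
  moreover have "\<forall>i<(LEAST k. step (s k) \<noteq> None). step (s i) = None"
    using not_less_Least by blast
  ultimately show ?r
    by blast
next
  assume ?r
  then obtain k r where k: "r \<in> A" "step (s k) = Some r" "\<forall>i<k. step (s i) = None"
    by blast
  have "(LEAST k. step (s k) \<noteq> None) = k"
    by (rule Least_equality) (use k in \<open>auto simp: not_less[symmetric]\<close>)
  with k show ?l
    by (auto simp: restart_until_success_def)
qed

text \<open>Rejection sampling in the abstract: one pass yields results with mass proportional to
  \<open>Q\<close>, and dividing by the acceptance probability \<open>c\<close> cancels the factor.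
  Measurability of \<open>step\<close> is expressed through preimages of sets of results, as in
  \<open>samples_from\<close>.\<close>

lemma (in prob_space) samples_from_restart:
  fixes Y :: "nat \<Rightarrow> 'a \<Rightarrow> 's" and step :: "'s \<Rightarrow> 'r option" and c :: real
  assumes indep: "indep_vars (\<lambda>_. D) Y UNIV" and law: "\<And>k. distr M D (Y k) = D"
    and Q: "prob_space Q" and c: "0 < c"
    and range: "\<And>s r. s \<in> space D \<Longrightarrow> step s = Some r \<Longrightarrow> r \<in> space Q"
    and sets: "\<And>A. A \<in> sets Q \<Longrightarrow> {s \<in> space D. \<exists>r\<in>A. step s = Some r} \<in> sets D"
    and step: "\<And>A. A \<in> sets Q \<Longrightarrow>
      measure D {s \<in> space D. \<exists>r\<in>A. step s = Some r} = c * measure Q A"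
  shows "samples_from M (\<lambda>w. restart_until_success step (\<lambda>k. Y k w)) Q"
proof -
  interpret Q: prob_space Q
    by fact
  define V where "V A = {s \<in> space D. \<exists>r\<in>A. step s = Some r}" for A
  define out where "out w = restart_until_success step (\<lambda>k. Y k w)" for w
  have Y: "Y k \<in> measurable M D" for k
    using indep by (auto simp: indep_vars_def)
  have V: "V A \<in> sets D" "measure D (V A) = c * measure Q A" if "A \<in> sets Q" for A
    using that sets step by (auto simp: V_def)
  \<comment> \<open>As \<open>Q\<close> has total mass 1, the factor \<open>c\<close> is the
    probability that a pass is accepted.\<close>
  have U: "measure D (V (space Q)) = c"
    using V(2)[OF sets.top] Q.prob_space by simp
  have ev: "{w \<in> space M. \<exists>r\<in>A. out w = Some r} =
      {w \<in> space M. \<exists>k. Y k w \<in> V A \<and> (\<forall>i<k. Y i w \<notin> V (space Q))}" for A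
  proof -
    \<comment> \<open>By \<open>range\<close> no result falls outside \<open>space Q\<close>, so
      missing \<open>V (space Q)\<close> is the same as restarting.\<close>
    have "Y k w \<in> V (space Q) \<longleftrightarrow> step (Y k w) \<noteq> None" if "w \<in> space M" for k w
      using measurable_space[OF Y that] range by (auto simp: V_def)
    moreover have "Y k w \<in> V A \<longleftrightarrow> (\<exists>r\<in>A. step (Y k w) = Some r)" if "w \<in> space M" for k w
      using measurable_space[OF Y that] by (auto simp: V_def)
    ultimately show ?thesis
      by (intro Collect_cong conj_cong) (simp_all add: out_def restart_until_success_iff)
  qed
  have out: "{w \<in> space M. \<exists>r\<in>A. out w = Some r} \<in> events"
    "prob {w \<in> space M. \<exists>r\<in>A. out w = Some r} = measure Q A" if A: "A \<in> sets Q" for A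
  proof -
    have sub: "V A \<subseteq> V (space Q)"
      using sets.sets_into_space[OF A] by (auto simp: V_def)
    have pos: "0 < measure D (V (space Q))"
      using c U by simp
    note * = first_success[OF indep law V(1)[OF sets.top] V(1)[OF A] sub pos]
    show "{w \<in> space M. \<exists>r\<in>A. out w = Some r} \<in> events"
      unfolding ev by (rule *(1))
    show "prob {w \<in> space M. \<exists>r\<in>A. out w = Some r} = measure Q A"
      unfolding ev using *(2) U V(2)[OF A] c by simp
  qed
  \<comment> \<open>Termination is the case \<open>A = space Q\<close>, which has probability
    1.\<close>
  have "AE w in M. w \<in> {w \<in> space M. \<exists>r\<in>space Q. out w = Some r}"
    using out[OF sets.top] Q.prob_space by (intro AE_in_set_eq_1[THEN iffD2]) auto
  then have "AE w in M. out w \<noteq> None"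
    by eventually_elim auto
  then show ?thesis
    using out by (auto simp: samples_from_def emeasure_eq_measure Q.emeasure_eq_measure
        simp flip: out_def)
qed

text \<open>Splitting the event by the value of \<open>Z\<close>, which almost surely lies in the
  countable set \<open>S\<close>, leaves disjoint pieces; each is the preimage of a rectangle, where
  independence gives a product.\<close>

lemma (in prob_space) emeasure_indep_var_atoms:
  assumes indep: "indep_var N1 Y N2 Z"
    and S: "countable S" "\<And>y. y \<in> S \<Longrightarrow> {y} \<in> sets N2" "AE \<omega> in M. Z \<omega> \<in> S"
    and B: "B \<in> sets (N1 \<Otimes>\<^sub>M N2)"
  shows "emeasure M {\<omega> \<in> space M. (Y \<omega>, Z \<omega>) \<in> B} =
    (\<integral>\<^sup>+ y. emeasure (distr M N1 Y) {x \<in> space N1. (x, y) \<in> B} * emeasure (distr M N2 Z) {y}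
      \<partial>count_space S)"
proof -
  have Y [measurable]: "Y \<in> measurable M N1" and Z [measurable]: "Z \<in> measurable M N2"
    using indep_var_rv1[OF indep] indep_var_rv2[OF indep] by auto
  note [measurable] = B
  have sec: "{x \<in> space N1. (x, y) \<in> B} \<in> sets N1" if "y \<in> S" for y
  proof -
    have "y \<in> space N2"
      using sets.sets_into_space[OF S(2)[OF that]] by simp
    then show ?thesis
      by measurable
  qed
  define G where "G y = {\<omega> \<in> space M. (Y \<omega>, Z \<omega>) \<in> {x \<in> space N1. (x, y) \<in> B} \<times> {y}}" for y
  have G_eq: "G y = (Y -` {x \<in> space N1. (x, y) \<in> B} \<inter> space M) \<inter> (Z -` {y} \<inter> space M)" for y
    by (auto simp: G_def)
  have G: "G y \<in> events" if "y \<in> S" for y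
    unfolding G_eq using measurable_sets[OF Y sec[OF that]] measurable_sets[OF Z S(2)[OF that]]
    by auto
  have "emeasure M {\<omega> \<in> space M. (Y \<omega>, Z \<omega>) \<in> B} = emeasure M (\<Union>y\<in>S. G y)"
  proof (rule emeasure_eq_AE)
    show "AE \<omega> in M. \<omega> \<in> {\<omega> \<in> space M. (Y \<omega>, Z \<omega>) \<in> B} \<longleftrightarrow> \<omega> \<in> (\<Union>y\<in>S. G y)"
      using S(3) by eventually_elim (use measurable_space[OF Y] in \<open>auto simp: G_def\<close>)
  qed (use G S(1) in \<open>auto intro: sets.countable_UN'\<close>)
  also have "\<dots> = (\<integral>\<^sup>+ y. emeasure M (G y) \<partial>count_space S)"
    using G S(1) by (intro emeasure_UN_countable) (auto simp: disjoint_family_on_def G_def)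
  also have "\<dots> = (\<integral>\<^sup>+ y. emeasure (distr M N1 Y) {x \<in> space N1. (x, y) \<in> B} *
      emeasure (distr M N2 Z) {y} \<partial>count_space S)"
  proof (rule nn_integral_cong)
    fix y assume "y \<in> space (count_space S)"
    then have y: "y \<in> S"
      by simp
    have "G y = (\<lambda>\<omega>. (Y \<omega>, Z \<omega>)) -` ({x \<in> space N1. (x, y) \<in> B} \<times> {y}) \<inter> space M"
      by (auto simp: G_def)
    with indep_varD[OF indep sec[OF y] S(2)[OF y]]
    show "emeasure M (G y) = emeasure (distr M N1 Y) {x \<in> space N1. (x, y) \<in> B} *
        emeasure (distr M N2 Z) {y}"
      using sec[OF y] S(2)[OF y] by (simp add: emeasure_distr emeasure_eq_measure ennreal_mult)
  qed
  finally show ?thesis .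
qed

text \<open>The points of \<open>C\<close> with mass zero form a countable union of null sets; what
  remains of \<open>C\<close> consists of atoms.\<close>

lemma (in finite_measure) AE_atom:
  assumes "countable C" and meas: "\<And>x. x \<in> C \<Longrightarrow> {x} \<in> sets M" and AE: "AE x in M. x \<in> C"
  shows "AE x in M. 0 < measure M {x}"
proof -
  have "AE x in M. \<forall>c\<in>C. measure M {c} = 0 \<longrightarrow> x \<noteq> c"
    using \<open>countable C\<close>
  proof (rule AE_ball_countable[THEN iffD2], intro ballI)
    fix c assume c: "c \<in> C"
    show "AE x in M. measure M {c} = 0 \<longrightarrow> x \<noteq> c"
    proof (cases "measure M {c} = 0")
      case True
      then have "{c} \<in> null_sets M"
        using meas[OF c] by (auto simp: emeasure_eq_measure)
      from AE_not_in[OF this] show ?thesis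
        by eventually_elim auto
    qed auto
  qed
  with AE show ?thesis
    by eventually_elim (auto simp: zero_less_measure_iff)
qed

text \<open>Finite total mass leaves room for only finitely many points at least as heavy as
  \<open>a\<close>. The heaviest of these is the heaviest of all, because every other point is
  lighter than \<open>a\<close>.\<close>

lemma (in finite_measure) ex_max_atom:
  assumes "0 < measure M {a}"
  obtains b where "\<And>x. measure M {x} \<le> measure M {b}"
proof -
  define L where "L = {x. measure M {a} \<le> measure M {x}}"
  \<comment> \<open>A non-measurable set has \<open>measure\<close> 0 by default, so positive mass
    entails measurability.\<close>
  have L_sets: "{x} \<in> sets M" if "x \<in> L" for x
    using that assms measure_notin_sets[of "{x}" M] by (force simp: L_def)
  have card_le: "real (card F) * measure M {a} \<le> measure M (space M)"
    if F: "F \<subseteq> L" "finite F" for F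
  proof -
    have "real (card F) * measure M {a} = (\<Sum>x\<in>F. measure M {a})"
      by simp
    also have "\<dots> \<le> (\<Sum>x\<in>F. measure M {x})"
      using F by (intro sum_mono) (auto simp: L_def)
    also have "\<dots> = measure M F"
      using F L_sets by (intro finite_measure_eq_sum_singleton[symmetric]) auto
    finally show ?thesis
      using bounded_measure[of F] by simp
  qed
  have "finite L"
  proof (rule ccontr)
    assume inf: "infinite L"
    obtain k :: nat where "measure M (space M) / measure M {a} < k"
      using reals_Archimedean2 by blast
    moreover obtain F where "F \<subseteq> L" "finite F" "card F = k"
      using infinite_arbitrarily_large[OF inf] by blast
    ultimately show False
      using card_le[of F] assms by (simp add: field_simps)
  qed
  moreover have "a \<in> L"
    by (simp add: L_def)
  ultimately obtain b where "b \<in> L" "\<forall>x\<in>L. measure M {x} \<le> measure M {b}"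
    using Max_in[of "(\<lambda>x. measure M {x}) ` L"] Max_ge[of "(\<lambda>x. measure M {x}) ` L"]
    by (metis (no_types, lifting) empty_iff finite_imageI image_iff image_eqI)
  then show thesis
    by (intro that[of b]) (metis L_def linorder_le_cases mem_Collect_eq order_trans)
qed

text \<open>Trades the description operator in \<open>completion\<close> for the condition
  \<open>place n I x y \<in> E\<close>, whose sections in \<open>x\<close> can be shown measurable.
  Uniqueness from (DSH) gives the completable case; otherwise both sides fail.\<close>

lemma completion_iff:
  assumes "DSH n I E" and "x \<in> ({1..n} - I) \<rightarrow>\<^sub>E UNIV"
  shows "y \<in> I \<rightarrow>\<^sub>E UNIV \<and> place n I x y \<in> E \<longleftrightarrow>
    x \<in> completable n I E \<and> y = completion n I E x" (is "?P y \<longleftrightarrow> _")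
proof (cases "x \<in> completable n I E")
  case True
  then have "\<exists>!y. ?P y"
    using assms(1) by (simp add: DSH_def)
  then have "?P (completion n I E x)" and "?P y \<Longrightarrow> completion n I E x = y"
    unfolding completion_def by (rule theI', rule the1_equality)
  with True show ?thesis
    by blast
next
  case False
  then show ?thesis
    using assms(2) by (auto simp: completable_def)
qed

lemma subvec_eq_place:
  assumes "I \<subseteq> {1..n}"
  shows "subvec {1..n} X \<omega> = place n I (subvec ({1..n} - I) X \<omega>) (subvec I X \<omega>)"
  using assms by (auto simp: subvec_def place_def merge_def fun_eq_iff)

lemma measurable_place:
  assumes "I \<subseteq> {1..n}"
  shows "(\<lambda>(x, y). place n I x y) \<in> measurable (RVec ({1..n} - I) \<Otimes>\<^sub>M RVec I) (RVec {1..n})"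
proof -
  have "merge ({1..n} - I) I \<in> measurable (RVec ({1..n} - I) \<Otimes>\<^sub>M RVec I) (RVec {1..n})"
    using measurable_merge[of "{1..n} - I" I "\<lambda>_. borel :: real measure"] assms
    by (simp add: Un_absorb2)
  then show ?thesis
    by (simp add: place_def case_prod_unfold)
qed

lemma singleton_in_sets_RVec:
  assumes "finite J" "y \<in> J \<rightarrow>\<^sub>E UNIV"
  shows "{y} \<in> sets (RVec J)"
proof -
  have "{y} = (\<Pi>\<^sub>E j\<in>J. {y j})"
    using assms(2) by (subst PiE_singleton) (auto simp: PiE_iff)
  also have "\<dots> \<in> sets (RVec J)"
    using assms(1) by (intro sets_PiM_I_finite) auto
  finally show ?thesis .
qed

lemma discrete_subvec:
  assumes J: "finite J" and X: "\<And>j. j \<in> J \<Longrightarrow> discrete_rv M (X j)"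
  obtains C where "countable C" "C \<subseteq> J \<rightarrow>\<^sub>E UNIV" "AE \<omega> in M. subvec J X \<omega> \<in> C"
proof -
  obtain S where S: "\<And>j. j \<in> J \<Longrightarrow> countable (S j) \<and> (AE \<omega> in M. X j \<omega> \<in> S j)"
    using X unfolding discrete_rv_def by metis
  show thesis
  proof
    show "countable (Pi\<^sub>E J S)"
      using J S by (intro countable_PiE) auto
    have "AE \<omega> in M. \<forall>j\<in>J. X j \<omega> \<in> S j"
      using J S by (intro AE_finite_allI) auto
    then show "AE \<omega> in M. subvec J X \<omega> \<in> Pi\<^sub>E J S"
      by eventually_elim (auto simp: subvec_def)
  qed auto
qed

lemma
  shows space_uniform01: "space uniform01 = {0<..<1}"
    and prob_space_uniform01: "prob_space uniform01"
    and sets_uniform01_lessThan: "{0<..<1} \<inter> {..<c} \<in> sets uniform01"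
    and emeasure_uniform01_lessThan:
      "0 \<le> c \<Longrightarrow> c \<le> 1 \<Longrightarrow> emeasure uniform01 ({0<..<1} \<inter> {..<c}) = ennreal c"
proof -
  show sp: "space uniform01 = {0<..<1}"
    by (simp add: uniform01_def space_restrict_space)
  show "prob_space uniform01"
    by (rule prob_spaceI) (simp only: sp, simp add: uniform01_def emeasure_restrict_space)
  show "{0<..<1} \<inter> {..<c} \<in> sets uniform01"
    by (simp add: uniform01_def sets_restrict_space)
  assume c: "0 \<le> c" "c \<le> 1"
  then have "{0<..<1} \<inter> {..<c} = {0<..<c}"
    by auto
  with c show "emeasure uniform01 ({0<..<1} \<inter> {..<c}) = ennreal c"
    by (simp add: uniform01_def) (subst emeasure_restrict_space, auto)
qed

theorem theorem4p1:
  fixes M :: "'w measure" and X :: "nat \<Rightarrow> 'w \<Rightarrow> real" and n :: nat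
    and T :: "(nat \<Rightarrow> real) \<Rightarrow> 'b::t2_space" and t :: 'b
    and I :: "nat set" and E :: "(nat \<Rightarrow> real) set"
    and P :: "'v measure" and draw :: "nat \<Rightarrow> 'v \<Rightarrow> (nat \<Rightarrow> real) \<times> real"
    and D :: "((nat \<Rightarrow> real) \<times> real) measure"
  assumes "prob_space M"
    and "\<And>j. j \<in> {1..n} \<Longrightarrow> discrete_rv M (X j)"
    and "prob_space.indep_vars M (\<lambda>_. borel) X {1..n}"
    and "T \<in> borel_measurable (RVec {1..n})"
    and "discrete_rv M (\<lambda>\<omega>. T (subvec {1..n} X \<omega>))"
    and "t \<in> T ` ({1..n} \<rightarrow>\<^sub>E UNIV)"
    and "E = level_set n T t"
    and "I \<subseteq> {1..n}"
    and "DSH n I E"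
    and "condition_A1 M X n I E"
    and "condition_A2 M X n I E"
    \<comment> \<open>the randomness of the algorithm: independent draws from
      the law of the entries outside \<open>I\<close>, paired independently with a uniform variable\<close>
    and "D = distr M (RVec ({1..n} - I)) (subvec ({1..n} - I) X) \<Otimes>\<^sub>M uniform01"
    and "prob_space P"
    and "prob_space.indep_vars P (\<lambda>_. D) draw UNIV"
    and "\<And>k. distr P D (draw k) = D"
  shows "samples_from P
    (\<lambda>w. restart_until_success (attempt M X n I E) (\<lambda>k. draw k w))
    (cond_law M {\<omega> \<in> space M. T (subvec {1..n} X \<omega>) = t} (RVec {1..n}) (subvec {1..n} X))"
proof -
  interpret prob_space M
    by fact
  interpret P: prob_space P
    by fact
  note disc = assms(2) and I = assms(8) and DSH = assms(9)

  \<comment> \<open>The laws of the two blocks of coordinates and their independence\<close>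
  define J where "J = {1..n} - I"
  define Z where "Z = subvec {1..n} X"
  define \<nu> where "\<nu> = distr M (RVec J) (subvec J X)"
  define \<mu> where "\<mu> = distr M (RVec I) (subvec I X)"
  define m where "m = max_point_prob M X I"
  \<comment> \<open>The atoms of the law of \<open>X_I\<close>: exactly the completions that the
    test on \<open>u > 0\<close> can accept.\<close>
  define S where "S = {y. 0 < measure \<mu> {y}}"
  have finI: "finite I"
    using I finite_subset by blast
  have D: "D = \<nu> \<Otimes>\<^sub>M uniform01"
    using assms(12) by (simp add: \<nu>_def J_def)

  have indep: "indep_var (RVec J) (subvec J X) (RVec I) (subvec I X)"
    unfolding subvec_def[abs_def] using I by (intro indep_var_restrict[OF assms(3)]) (auto simp: J_def)
  note XJ [measurable] = indep_var_rv1[OF indep] and XI [measurable] = indep_var_rv2[OF indep]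
  interpret \<mu>: prob_space \<mu>
    unfolding \<mu>_def by (rule prob_space_distr) measurable
  interpret u: prob_space uniform01
    by (rule prob_space_uniform01)
  have space_\<nu>: "space \<nu> = J \<rightarrow>\<^sub>E UNIV" and space_\<mu>: "space \<mu> = I \<rightarrow>\<^sub>E UNIV"
    by (simp_all add: \<nu>_def \<mu>_def space_PiM)
  have sets_\<nu>: "sets \<nu> = sets (RVec J)" and sets_\<mu>: "sets \<mu> = sets (RVec I)"
    by (simp_all add: \<nu>_def \<mu>_def)

  \<comment> \<open>The law of \<open>X_I\<close> is carried by countably many atoms\<close>
  have S_space: "y \<in> I \<rightarrow>\<^sub>E UNIV" if "y \<in> S" for y
    \<comment> \<open>Positive \<open>measure\<close> makes \<open>{y}\<close> measurable, hence a
      subset of the space.\<close>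
    using that measure_notin_sets[of "{y}" \<mu>] sets.sets_into_space[of "{y}" \<mu>]
    by (force simp: S_def space_\<mu>)
  have countable_S: "countable S"
    using \<mu>.countable_support by (rule countable_subset[rotated]) (auto simp: S_def)
  have AE_S: "AE \<omega> in M. subvec I X \<omega> \<in> S"
  proof -
    \<comment> \<open>Discreteness provides some countable carrier \<open>C\<close>; discarding its
      points of mass zero leads into \<open>S\<close>.\<close>
    obtain C where C: "countable C" "C \<subseteq> I \<rightarrow>\<^sub>E UNIV" "AE \<omega> in M. subvec I X \<omega> \<in> C"
      using discrete_subvec[OF finI, of M X] disc I by (metis subsetD)
    have single: "{y} \<in> sets \<mu>" if "y \<in> C" for y
      using C(2) that singleton_in_sets_RVec[OF finI] by (auto simp: sets_\<mu>)
    have "C \<in> sets (RVec I)"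
      using sets.countable[OF single C(1)] by (simp add: sets_\<mu>)
    then have "AE y in \<mu>. y \<in> C"
      unfolding \<mu>_def using C(3) by (subst AE_distr_iff) (auto simp: Int_def[symmetric])
    from \<mu>.AE_atom[OF C(1) single this] have "AE y in \<mu>. y \<in> S"
      by (simp add: S_def)
    then show ?thesis
      unfolding \<mu>_def by (rule AE_distrD[OF XI])
  qed

  \<comment> \<open>The largest point probability and the acceptance ratios\<close>
  have point_prob: "point_prob M X I y = measure \<mu> {y}" if "y \<in> I \<rightarrow>\<^sub>E UNIV" for y
  proof -
    have "{\<omega> \<in> space M. subvec I X \<omega> = y} = subvec I X -` {y} \<inter> space M"
      by auto
    then show ?thesis
      using singleton_in_sets_RVec[OF finI that] by (simp add: point_prob_def \<mu>_def measure_distr)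
  qed
  have "S \<noteq> {}"
    using AE_S by auto
  then obtain a where a: "a \<in> S"
    by blast
  obtain b where b: "\<And>y. measure \<mu> {y} \<le> measure \<mu> {b}"
    using \<mu>.ex_max_atom[of a] a by (auto simp: S_def)
  have "b \<in> S"
    using b[of a] a by (auto simp: S_def)
  \<comment> \<open>The maximum is attained at \<open>b\<close>, so \<open>GREATEST\<close> denotes
    this value.\<close>
  have m: "m = measure \<mu> {b}"
    unfolding m_def max_point_prob_def
    using S_space[OF \<open>b \<in> S\<close>] b by (intro Greatest_equality) (auto simp: point_prob)
  have m_pos: "0 < m"
    using \<open>b \<in> S\<close> by (simp add: m S_def)
  have ratio: "0 \<le> measure \<mu> {y} / m" "measure \<mu> {y} / m \<le> 1" for y
    using b[of y] m_pos by (auto simp: m)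

  \<comment> \<open>Measurability of \<open>E\<close> and uniqueness of completions\<close>
  have Z_meas [measurable]: "Z \<in> measurable M (RVec {1..n})"
    unfolding Z_def subvec_def[abs_def] using disc by (intro measurable_restrict) (auto simp: discrete_rv_def)
  have E_sets: "E \<in> sets (RVec {1..n})"
  proof -
    have "E = T -` {t} \<inter> space (RVec {1..n})"
      by (auto simp: assms(7) level_set_def space_PiM)
    then show ?thesis
      \<comment> \<open>In a Hausdorff space \<open>{t}\<close> is closed, hence Borel.\<close>
      using measurable_sets[OF assms(4), of "{t}"] by simp
  qed
  have comp: "y \<in> I \<rightarrow>\<^sub>E UNIV \<and> place n I x y \<in> E \<longleftrightarrow>
      x \<in> completable n I E \<and> y = completion n I E x" if "x \<in> space \<nu>" for x y
    using completion_iff[OF DSH] that by (simp add: space_\<nu> J_def)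

  \<comment> \<open>The probability of \<open>E \<inter> A\<close> as a sum over the atoms of
    \<open>X_I\<close>\<close>
  define F where "F A y = {x \<in> space \<nu>. place n I x y \<in> E \<inter> A}" for A y
  define B where
    "B A = (\<lambda>(x, y). place n I x y) -` (E \<inter> A) \<inter> space (RVec J \<Otimes>\<^sub>M RVec I)" for A
  have B: "B A \<in> sets (RVec J \<Otimes>\<^sub>M RVec I)" if "A \<in> sets (RVec {1..n})" for A
    unfolding B_def J_def using E_sets that
    by (intro measurable_sets[OF measurable_place[OF I]] sets.Int)
  have F_B: "F A y = {x \<in> space (RVec J). (x, y) \<in> B A}" if "y \<in> S" for A y
    using S_space[OF that] by (auto simp: F_def B_def \<nu>_def space_pair_measure space_PiM)
  have F: "F A y \<in> sets \<nu>" if A: "A \<in> sets (RVec {1..n})" and y: "y \<in> S" for A y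
  proof -
    have "F A y = (\<lambda>x. (x, y)) -` B A"
      using sets.sets_into_space[OF B[OF A]] by (auto simp: F_B[OF y] space_pair_measure)
    then show ?thesis
      using sets_Pair2[OF B[OF A], of y] by (simp add: sets_\<nu>)
  qed
  \<comment> \<open>The acceptance probability of a pass will be this same sum with the factor
    \<open>1 / m\<close>.\<close>
  have Z_prob: "emeasure M (Z -` (E \<inter> A) \<inter> space M) =
      (\<integral>\<^sup>+ y. emeasure \<nu> (F A y) * emeasure \<mu> {y} \<partial>count_space S)"
    if A: "A \<in> sets (RVec {1..n})" for A
  proof -
    have "(subvec J X \<omega>, subvec I X \<omega>) \<in> space (RVec J \<Otimes>\<^sub>M RVec I)" for \<omega>
      by (simp add: space_pair_measure space_PiM subvec_def)
    moreover have "place n I (subvec J X \<omega>) (subvec I X \<omega>) = Z \<omega>" for \<omega>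
      unfolding Z_def J_def using subvec_eq_place[OF I] by metis
    ultimately
    have "Z -` (E \<inter> A) \<inter> space M = {\<omega> \<in> space M. (subvec J X \<omega>, subvec I X \<omega>) \<in> B A}"
      by (auto simp: B_def)
    also have "emeasure M \<dots> =
        (\<integral>\<^sup>+ y. emeasure \<nu> {x \<in> space (RVec J). (x, y) \<in> B A} * emeasure \<mu> {y} \<partial>count_space S)"
      unfolding \<nu>_def \<mu>_def
      using countable_S S_space singleton_in_sets_RVec[OF finI] AE_S B[OF A]
      by (intro emeasure_indep_var_atoms[OF indep]) auto
    also have "\<dots> = (\<integral>\<^sup>+ y. emeasure \<nu> (F A y) * emeasure \<mu> {y} \<partial>count_space S)"
      by (intro nn_integral_cong) (simp add: F_B)
    finally show ?thesis .
  qed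

  \<comment> \<open>The acceptance probability of a single pass\<close>
  define V where "V A = {s \<in> space D. \<exists>r\<in>A. attempt M X n I E s = Some r}" for A
  \<comment> \<open>As \<open>u > 0\<close>, only the countably many atoms of the law of \<open>X\<^sub>I\<close> can be accepted; hence
    measurability does not require \<open>completable n I E\<close>, the projection of a Borel set,
    to be Borel.\<close>
  have V_eq: "V A = (\<Union>y\<in>S. F A y \<times> ({0<..<1} \<inter> {..<measure \<mu> {y} / m}))" for A
  proof -
    have "(x, u) \<in> V A \<longleftrightarrow> (\<exists>y\<in>S. x \<in> F A y \<and> 0 < u \<and> u < 1 \<and> u < measure \<mu> {y} / m)" for x u
    proof (cases "x \<in> space \<nu> \<and> 0 < u \<and> u < 1")
      case True
      then have x: "x \<in> space \<nu>"
        by simp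
      have "(x, u) \<in> V A \<longleftrightarrow>
          (\<exists>y. (x \<in> completable n I E \<and> y = completion n I E x) \<and>
            u < point_prob M X I y / m \<and> place n I x y \<in> A)"
        using True by (auto simp: V_def D space_pair_measure space_uniform01 attempt_def m_def)
      also have "\<dots> \<longleftrightarrow> (\<exists>y. (y \<in> I \<rightarrow>\<^sub>E UNIV \<and> place n I x y \<in> E) \<and>
            u < point_prob M X I y / m \<and> place n I x y \<in> A)"
        by (simp only: comp[OF x])
      also have "\<dots> \<longleftrightarrow> (\<exists>y\<in>S. place n I x y \<in> E \<inter> A \<and> u < measure \<mu> {y} / m)"
      proof -
        have "y \<in> S" if "u < measure \<mu> {y} / m" for y
        proof -
          have "0 < measure \<mu> {y} / m"
            using True that by linarith
          then show ?thesis
            using m_pos by (simp add: S_def zero_less_divide_iff)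
        qed
        then show ?thesis
          by (metis Int_iff S_space point_prob)
      qed
      finally show ?thesis
        using True by (auto simp: F_def)
    qed (auto simp: V_def F_def D space_pair_measure space_uniform01)
    then show ?thesis
      by auto
  qed
  have V_sets: "V A \<in> sets D" if A: "A \<in> sets (RVec {1..n})" for A
    unfolding V_eq D using F[OF A] sets_uniform01_lessThan countable_S
    by (intro sets.countable_UN') auto
  have V_prob: "measure D (V A) = prob (Z -` (E \<inter> A) \<inter> space M) / m"
    if A: "A \<in> sets (RVec {1..n})" for A
  proof -
    let ?G = "\<lambda>y. F A y \<times> ({0<..<1} \<inter> {..<measure \<mu> {y} / m})"
    have disj: "disjoint_family_on ?G S"
    proof -
      \<comment> \<open>This is (DSH): a given \<open>x\<close> has a single completion.\<close>
      have "y = y'" if "y \<in> S" "y' \<in> S" "x \<in> F A y" "x \<in> F A y'" for x y y'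
        using that comp[of x y] comp[of x y'] S_space[of y] S_space[of y'] by (auto simp: F_def)
      then show ?thesis
        unfolding disjoint_family_on_def by blast
    qed
    have "emeasure D (V A) = (\<integral>\<^sup>+ y. emeasure D (?G y) \<partial>count_space S)"
      unfolding V_eq using F[OF A] sets_uniform01_lessThan countable_S disj
      by (intro emeasure_UN_countable) (auto simp: D)
    also have "\<dots> = (\<integral>\<^sup>+ y. ennreal (1 / m) * (emeasure \<nu> (F A y) * emeasure \<mu> {y}) \<partial>count_space S)"
    proof (rule nn_integral_cong)
      fix y assume "y \<in> space (count_space S)"
      \<comment> \<open>The ratio lies between 0 and 1, so the accepted \<open>u\<close> form an
        interval whose length is the ratio itself.\<close>
      then have "emeasure D (?G y) = emeasure \<nu> (F A y) * ennreal (1 / m * measure \<mu> {y})"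
        using F[OF A] ratio[of y] sets_uniform01_lessThan
        by (simp add: D u.emeasure_pair_measure_Times emeasure_uniform01_lessThan)
      also have "ennreal (1 / m * measure \<mu> {y}) = ennreal (1 / m) * emeasure \<mu> {y}"
        using m_pos by (subst ennreal_mult) (auto simp: \<mu>.emeasure_eq_measure)
      finally show "emeasure D (?G y) = ennreal (1 / m) * (emeasure \<nu> (F A y) * emeasure \<mu> {y})"
        by (simp add: mult_ac)
    qed
    also have "\<dots> = ennreal (1 / m) * emeasure M (Z -` (E \<inter> A) \<inter> space M)"
      unfolding Z_prob[OF A] by (rule nn_integral_cmult) simp
    also have "\<dots> = ennreal (prob (Z -` (E \<inter> A) \<inter> space M) / m)"
      using m_pos by (simp add: emeasure_eq_measure flip: ennreal_mult)
    finally show ?thesis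
      using m_pos by (simp add: measure_def)
  qed

  \<comment> \<open>The conditioning event has positive probability\<close>
  define ZE where "ZE = Z -` E \<inter> space M"
  have ZE_sets: "ZE \<in> events"
    unfolding ZE_def using E_sets by (rule measurable_sets[OF Z_meas])
  have ZE_pos: "0 < prob ZE"
  \<comment> \<open>If \<open>E\<close> were null, every term of the sum would vanish. The atoms
    have positive mass, so each \<open>F ?A y\<close> would be null, and almost surely the entries
    outside \<open>I\<close> would have no completion of positive probability, against (A2).\<close>
  proof (rule ccontr)
    let ?A = "space (RVec {1..n})"
    assume "\<not> 0 < prob ZE"
    then have "emeasure M (Z -` (E \<inter> ?A) \<inter> space M) = 0"
      using sets.sets_into_space[OF E_sets]
      by (simp add: ZE_def emeasure_eq_measure zero_less_measure_iff Int_absorb2)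
    then have "AE y in count_space S. emeasure \<nu> (F ?A y) * emeasure \<mu> {y} = 0"
      unfolding Z_prob[OF sets.top] by (subst (asm) nn_integral_0_iff_AE) auto
    then have null: "F ?A y \<in> null_sets \<nu>" if "y \<in> S" for y
      using that F[OF sets.top that] by (auto simp: AE_count_space S_def \<mu>.emeasure_eq_measure)
    have "AE x in \<nu>. \<forall>y\<in>S. x \<notin> F ?A y"
      using countable_S null by (intro AE_ball_countable[THEN iffD2]) (auto intro: AE_not_in)
    then have "AE \<omega> in M. \<forall>y\<in>S. subvec J X \<omega> \<notin> F ?A y"
      unfolding \<nu>_def by (rule AE_distrD[OF XJ])
    then have "AE \<omega> in M. \<not> completion_prob M X n I E (subvec J X \<omega>) > 0"
    proof eventually_elim
      case (elim \<omega>)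
      define x where "x = subvec J X \<omega>"
      have x: "x \<in> space \<nu>"
        by (simp add: x_def space_\<nu> subvec_def)
      have "\<not> 0 < point_prob M X I (completion n I E x)" if "x \<in> completable n I E"
        using elim comp[OF x, of "completion n I E x"] that sets.sets_into_space[OF E_sets] x
        by (auto simp: F_def S_def point_prob simp flip: x_def)
      then show ?case
        by (auto simp: completion_prob_def simp flip: x_def)
    qed
    then have AE: "AE \<omega> in M. \<omega> \<notin> {\<omega> \<in> space M. completion_prob M X n I E (subvec J X \<omega>) > 0}"
      (is "AE \<omega> in M. \<omega> \<notin> ?W")
      by eventually_elim simp
    have "0 < prob ?W"
      using assms(11) by (simp only: condition_A2_def J_def)
    \<comment> \<open>The positive \<open>measure\<close> in (A2) itself shows that this set is an
      event.\<close>
    moreover from this have "?W \<in> events"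
      using measure_notin_sets[of ?W M] by linarith
    ultimately show False
      using AE by (simp only: prob_eq_0[symmetric])
  qed

  \<comment> \<open>The conditional law as the output of the loop\<close>
  let ?Q = "distr (uniform_measure M ZE) (RVec {1..n}) Z"
  have Z_cond: "Z \<in> measurable (uniform_measure M ZE) (RVec {1..n})"
    using Z_meas measurable_cong_sets[OF sets_uniform_measure refl] by blast
  have Q_prob: "measure ?Q A = prob (Z -` (E \<inter> A) \<inter> space M) / prob ZE"
    if A: "A \<in> sets (RVec {1..n})" for A
  proof -
    have "measure ?Q A = measure (uniform_measure M ZE) (Z -` A \<inter> space M)"
      using measure_distr[OF Z_cond A] by simp
    also have "\<dots> = prob (ZE \<inter> (Z -` A \<inter> space M)) / prob ZE"
      using ZE_sets ZE_pos measurable_sets[OF Z_meas A]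
      by (intro measure_uniform_measure) (auto simp: emeasure_eq_measure)
    also have "ZE \<inter> (Z -` A \<inter> space M) = Z -` (E \<inter> A) \<inter> space M"
      by (auto simp: ZE_def)
    finally show ?thesis .
  qed
  have "samples_from P (\<lambda>w. restart_until_success (attempt M X n I E) (\<lambda>k. draw k w)) ?Q"
  proof (rule P.samples_from_restart[OF assms(14) assms(15)])
    show "prob_space ?Q"
      using ZE_pos by (intro prob_space.prob_space_distr[OF _ Z_cond] prob_space_uniform_measure)
        (auto simp: emeasure_eq_measure)
    \<comment> \<open>The factor \<open>c\<close> is \<open>prob ZE / m\<close>; multiplied by the
      conditional probability of \<open>A\<close> it gives the \<open>V_prob\<close> value.\<close>
    show "0 < prob ZE / m"
      using ZE_pos m_pos by simp
    show "r \<in> space ?Q" if "s \<in> space D" "attempt M X n I E s = Some r" for s r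
    proof -
      \<comment> \<open>An accepted result is \<open>x\<close> with its own completion, which lies
        in \<open>E\<close> by \<open>comp\<close>.\<close>
      have "r \<in> E"
        using that comp[THEN iffD2, of "fst s" "completion n I E (fst s)"]
        by (auto simp: attempt_def D space_pair_measure split: if_splits)
      then show ?thesis
        using sets.sets_into_space[OF E_sets] by auto
    qed
    show "{s \<in> space D. \<exists>r\<in>A. attempt M X n I E s = Some r} \<in> sets D" if "A \<in> sets ?Q" for A
      using V_sets[of A] that by (simp add: V_def)
    show "measure D {s \<in> space D. \<exists>r\<in>A. attempt M X n I E s = Some r} =
        prob ZE / m * measure ?Q A" if "A \<in> sets ?Q" for A
      using V_prob[of A] Q_prob[of A] that ZE_pos by (simp add: V_def)
  qed
  moreover have "{\<omega> \<in> space M. T (subvec {1..n} X \<omega>) = t} = ZE"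
    by (auto simp: ZE_def Z_def assms(7) level_set_def subvec_def)
  ultimately show ?thesis
    by (simp add: cond_law_def Z_def)
qed

end
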